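(* For every integer $n\ge 0$, in Inverse Treblecross the empty board with $n$ cells has Sprague-Grundy value $0$ (i.e. the second player wins) if and only if $n\equiv 0,2,3,6,9 \pmod{10}$. In the remaining cases, i.e. when $n\equiv 1,4,5,7,8\pmod{10}$, its Sprague-Grundy value is $1$.
   Context: Inverse Treblecross is the following impartial game. The board is a row ($1\times n$ strip) of cells, each either empty or occupied by a piece $X$, with no three consecutive cells all occupied. Two players alternately move; a move consists of placing a piece $X$ on an empty cell in such a way that no three consecutive cells of the board are all occupied afterwards (moves creating three in a row are prohibited). Play is under the normal play convention: a player who has no legal move loses. The Sprague-Grundy (SG) value of a position is the minimum excludant (mex) of the SG values of all positions reachable from it by one legal move; a position has SG value $0$ exactly when the player to move loses under optimal play. *)

theory Defs
  imports Main
begin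

text \<open>A board is a list of cells; a cell is \<open>True\<close> iff it carries a piece X.\<close>

type_synonym board = "bool list"

definition empty_board :: "nat \<Rightarrow> board" where
  "empty_board n = replicate n False"

definition no_three :: "board \<Rightarrow> bool" where
  "no_three b \<longleftrightarrow> \<not> (\<exists>i. i + 2 < length b \<and> b ! i \<and> b ! (i + 1) \<and> b ! (i + 2))"

text \<open>A board that already contains three consecutive pieces is not a position of the game;
  such boards have no moves here and are not reachable from an empty board.\<close>

definition move :: "board \<Rightarrow> board \<Rightarrow> bool" where
  "move b c \<longleftrightarrow> (\<exists>i < length b. \<not> b ! i \<and> c = b[i := True] \<and> no_three c)"

definition mex :: "nat set \<Rightarrow> nat" where
  "mex A = (LEAST k. k \<notin> A)"

lemma move_fewer_empty_cells:
  assumes "move b c"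
  shows "length (filter Not c) < length (filter Not b)"
proof -
  from assms obtain i where i: "i < length b" "\<not> b ! i" "c = b[i := True]"
    by (auto simp: move_def)
  have b: "take i b @ False # drop (Suc i) b = b"
    using id_take_nth_drop[OF i(1), symmetric] i(2) by simp
  have c: "take i b @ True # drop (Suc i) b = c"
    using upd_conv_take_nth_drop[OF i(1), of True, symmetric] i(3) by simp
  have "length (filter Not (take i b @ True # drop (Suc i) b))
      < length (filter Not (take i b @ False # drop (Suc i) b))"
    by simp
  then show ?thesis
    unfolding b c .
qed

function sg :: "board \<Rightarrow> nat" where
  "sg b = mex (sg ` {c. move b c})"
  by auto
termination
  by (relation "measure (\<lambda>b. length (filter Not b))") (auto intro: move_fewer_empty_cells)

text \<open>The defining equation of \<open>sg\<close> loops as a rewrite rule.\<close>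
declare sg.simps [simp del]

text \<open>\<open>loses b\<close>: under normal play the player to move at \<open>b\<close> loses, that is, every move has
  a reply that leads to a losing position again (vacuously so if there is no move).\<close>

inductive loses :: "board \<Rightarrow> bool" where
  "(\<And>c. move b c \<Longrightarrow> \<exists>d. move c d \<and> loses d) \<Longrightarrow> loses b"

end

theory Submission imports Defs begin

text \<open>
  An empty cell is dead once a piece on it would complete three in a row.  It stays dead and empty
  for ever, so the parts of the board on its two sides never interact again: the game falls apart
  into a sum.  Two adjacent pieces kill the cells on both sides of them, and the standard reply is
  to put a piece next to the opponent's piece.  This turns an empty board into the sum of two
  shorter empty boards.

  A general position can have a value above 1, and no formula for it is needed.  Instead, the
  inductive relation \<open>valued\<close> assigns a value in \<open>{0, 1}\<close> (as a truth value) to a small class of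
  boards that is closed under good replies.  Its components are empty boards of any length, a
  single piece whose two empty arms have lengths congruent to 0, 2 or 3 modulo 5, two pieces at
  the ends of a gap of length congruent to 4 modulo 5, and a pair of adjacent pieces.  Components
  are joined by dead cells, and their values are added modulo 2.

  Two facts about a board with assigned value \<open>x\<close> suffice.  First, every move from it either leads
  to a valued board of the other value, or can be answered by a move to a valued board of the same
  value \<open>x\<close> (\<open>valued_answered\<close>).  Second, if \<open>x = 1\<close>, then some move leads to a valued board of value
  0 (\<open>valued_True_move\<close>).  By induction on the number of empty cells, the first fact shows that no
  option has Sprague-Grundy value \<open>x\<close>, and the second that all values below \<open>x\<close> occur among the
  options.  Hence the assigned value is the Sprague-Grundy value (\<open>valued_sg\<close>).  Both facts pass
  from the components to sums, since a reply can be made in the component in which the opponent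
  moved.

  The shape of the class is dictated by the moves for which making a pair fails.  On an empty board
  of more than one cell this happens only if the length is divisible by 5 and the opponent starts at
  an end; leaving one cell between the two pieces then kills that cell and leaves a single piece
  with one arm.  For a single piece it fails if the piece stands at one end of the board and the
  opponent plays at the other end, with a gap of length \<open>l > 1\<close> congruent to 1 modulo 5; the same
  kind of reply then leaves a gap congruent to 4 enclosed by two pieces.  In such a gap pairs always suffice.
\<close>

section \<open>Structure of boards and moves\<close>

lemma not_no_three_iff: "\<not> no_three b \<longleftrightarrow> (\<exists>u v. b = u @ True # True # True # v)"
proof
  assume "\<not> no_three b"
  then obtain i where i: "i + 2 < length b" "b ! i" "b ! (i + 1)" "b ! (i + 2)"
    by (auto simp: no_three_def)
  have "b = take i b @ b ! i # b ! (i + 1) # b ! (i + 2) # drop (i + 3) b"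
    using i(1) by (simp add: Cons_nth_drop_Suc numeral_3_eq_3)
  then show "\<exists>u v. b = u @ True # True # True # v"
    using i by metis
next
  assume "\<exists>u v. b = u @ True # True # True # v"
  then obtain u v where "b = u @ True # True # True # v" by blast
  then show "\<not> no_three b"
    by (auto simp: no_three_def nth_append intro!: exI[of _ "length u"])
qed

text \<open>An empty cell separates the two sides as far as the rule against three in a row is concerned;
  that is what makes a dead cell split the game into a sum.\<close>

lemma no_three_split: "no_three (u @ False # v) \<longleftrightarrow> no_three u \<and> no_three v"
proof -
  have "\<not> no_three (u @ False # v) \<longleftrightarrow> \<not> no_three u \<or> \<not> no_three v"
  proof
    assume "\<not> no_three (u @ False # v)"
    then obtain p q where "u @ False # v = p @ True # True # True # q"
      by (auto simp: not_no_three_iff)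
    then show "\<not> no_three u \<or> \<not> no_three v"
      by (auto simp: not_no_three_iff append_eq_append_conv2 append_eq_Cons_conv Cons_eq_append_conv)
  next
    assume "\<not> no_three u \<or> \<not> no_three v"
    then show "\<not> no_three (u @ False # v)"
      unfolding not_no_three_iff by (metis append_Cons append_assoc)
  qed
  then show ?thesis by blast
qed

lemma no_three_short [simp]: "length b < 3 \<Longrightarrow> no_three b"
  by (simp add: no_three_def)

lemma no_three_False_Cons [simp]: "no_three (False # v) \<longleftrightarrow> no_three v"
  using no_three_split[of "[]" v] by simp

lemma no_three_True_False [simp]: "no_three (True # False # v) \<longleftrightarrow> no_three v"
  using no_three_split[of "[True]" v] by simp

lemma no_three_replicate_append [simp]: "no_three (replicate n False @ v) \<longleftrightarrow> no_three v"
  by (induction n) auto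

lemma no_three_replicate [simp]: "no_three (replicate n False)"
  by (induction n) auto

lemma no_three_True_replicate [simp]: "no_three (True # replicate n False)"
  by (cases n) auto

lemma no_three_rev [simp]: "no_three (rev b) \<longleftrightarrow> no_three b"
proof -
  have *: "\<not> no_three b \<Longrightarrow> \<not> no_three (rev b)" for b
    by (auto simp: not_no_three_iff) (metis append.assoc append_Cons append_Nil)
  show ?thesis using *[of b] *[of "rev b"] by auto
qed

text \<open>Moves as a decomposition of lists: all further reasoning about moves uses this form
  instead of indices.\<close>

lemma move_iff: "move b c \<longleftrightarrow> (\<exists>u v. b = u @ False # v \<and> c = u @ True # v \<and> no_three c)"
proof
  assume "move b c"
  then obtain i where i: "i < length b" "\<not> b ! i" "c = b[i := True]" "no_three c"
    by (auto simp: move_def)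
  then show "\<exists>u v. b = u @ False # v \<and> c = u @ True # v \<and> no_three c"
    using id_take_nth_drop[OF i(1)] upd_conv_take_nth_drop[OF i(1), of True]
    by (intro exI[of _ "take i b"] exI[of _ "drop (Suc i) b"]) auto
next
  assume "\<exists>u v. b = u @ False # v \<and> c = u @ True # v \<and> no_three c"
  then show "move b c"
    unfolding move_def by (metis length_append length_Cons list_update_length nth_append_length
        less_add_same_cancel1 zero_less_Suc)
qed

lemma move_rev: "move b c \<Longrightarrow> move (rev b) (rev c)"
proof -
  assume "move b c"
  then obtain u v where "b = u @ False # v" "c = u @ True # v" "no_three c"
    by (auto simp: move_iff)
  then show "move (rev b) (rev c)"
    using no_three_rev[of c] unfolding move_iff
    by (intro exI[of _ "rev v"] exI[of _ "rev u"]) simp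
qed

text \<open>A dead cell stays dead: the three in a row on \<open>u @ True # v\<close> avoid the cell that the move fills,
  because that cell is still empty, so they are also there after the move.\<close>

lemma still_dead:
  assumes "\<not> no_three (u @ True # v)" and "move u u'"
  shows "\<not> no_three (u' @ True # v)"
proof -
  obtain p q where u: "u = p @ False # q" "u' = p @ True # q"
    using assms(2) by (auto simp: move_iff)
  then have "\<not> no_three p \<or> \<not> no_three (q @ True # v)"
    using assms(1) no_three_split[of p "q @ True # v"] by auto
  then show ?thesis
    unfolding u not_no_three_iff by (metis append_Cons append_assoc)
qed

lemma still_dead_right:
  assumes "\<not> no_three (u @ True # v)" and "move v v'"
  shows "\<not> no_three (u @ True # v')"
  using still_dead[of "rev v" "rev u" "rev v'"] move_rev[OF assms(2)] assms(1)
    no_three_rev[of "u @ True # v"] no_three_rev[of "u @ True # v'"] by simp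

text \<open>The lemma that turns a dead cell into a sum of games: the separating cell admits no move, and
  the legal moves are those of the two sides.\<close>

lemma move_in_sum:
  assumes "move (u @ False # v) c" and "\<not> no_three (u @ True # v)"
  obtains u' where "move u u'" "c = u' @ False # v"
    | v' where "move v v'" "c = u @ False # v'"
proof -
  obtain p q where pq: "u @ False # v = p @ False # q" "c = p @ True # q" "no_three c"
    using assms(1) by (auto simp: move_iff)
  consider "p = u" "q = v" | r where "u = p @ False # r" "q = r @ False # v"
    | r where "v = r @ False # q" "p = u @ False # r"
    using pq(1) by (auto simp: append_eq_append_conv2 append_eq_Cons_conv Cons_eq_append_conv)
  then show thesis
  proof cases
    case 1
    with pq assms(2) show ?thesis by simp
  next
    case (2 r)
    with pq show ?thesis
      using no_three_split[of "p @ True # r" v]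
      by (intro that(1)[of "p @ True # r"]) (auto simp: move_iff)
  next
    case (3 r)
    with pq show ?thesis
      using no_three_split[of u "r @ True # q"]
      by (intro that(2)[of "r @ True # q"]) (auto simp: move_iff)
  qed
qed

lemma move_sum_left:
  assumes "move u u'" and "no_three v"
  shows "move (u @ False # v) (u' @ False # v)"
proof -
  obtain p q where "u = p @ False # q" "u' = p @ True # q" "no_three u'"
    using assms(1) by (auto simp: move_iff)
  then show ?thesis
    unfolding move_iff using assms(2) no_three_split[of u' v]
    by (intro exI[of _ p] exI[of _ "q @ False # v"]) simp
qed

lemma move_sum_right:
  assumes "move v v'" and "no_three u"
  shows "move (u @ False # v) (u @ False # v')"
  using move_rev[OF move_sum_left[OF move_rev[OF assms(1)], of "rev u"]] assms(2) by simp

lemma move_replicate: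
  assumes "move (replicate n False) c"
  obtains l r where "n = l + r + 1" "c = replicate l False @ True # replicate r False"
proof -
  obtain u v where uv: "replicate n False = u @ False # v" "c = u @ True # v"
    using assms by (auto simp: move_iff)
  have "set (u @ False # v) \<subseteq> {False}"
    unfolding uv(1)[symmetric] by auto
  then have "u = replicate (length u) False" "v = replicate (length v) False"
    by (auto intro!: replicate_eqI)
  moreover have "n = length u + length v + 1"
    using arg_cong[OF uv(1), of length] by simp
  ultimately show thesis using that uv(2) by metis
qed

lemma move_around_piece:
  assumes "move (u @ True # v) c"
  obtains u' where "move u u'" "c = u' @ True # v"
    | v' where "move v v'" "c = u @ True # v'"
proof -
  obtain p q where pq: "u @ True # v = p @ False # q" "c = p @ True # q" "no_three c"
    using assms by (auto simp: move_iff)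
  have part: "no_three x \<and> no_three z" if "no_three (x @ y @ z)" for x y z
    using that not_no_three_iff by (metis append_assoc append_Cons)
  consider r where "u = p @ False # r" "q = r @ True # v"
    | r where "v = r @ False # q" "p = u @ True # r"
    using pq(1) by (auto simp: append_eq_append_conv2 append_eq_Cons_conv Cons_eq_append_conv)
  then show thesis
  proof cases
    case (1 r)
    with pq show ?thesis using part[of "p @ True # r" "[]" "True # v"]
      by (intro that(1)[of "p @ True # r"]) (auto simp: move_iff)
  next
    case (2 r)
    with pq show ?thesis using part[of u "[True]" "r @ True # q"]
      by (intro that(2)[of "r @ True # q"]) (auto simp: move_iff)
  qed
qed

section \<open>Boards of known value\<close>

definition empty_val :: "nat \<Rightarrow> bool" where
  "empty_val n \<longleftrightarrow> n mod 10 \<in> {1, 4, 5, 7, 8}"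

definition arm :: "nat \<Rightarrow> bool" where
  "arm a \<longleftrightarrow> a mod 5 \<in> {0, 2, 3}"

text \<open>The contribution of one arm to the value of a single piece.  It is the value of the empty board
  that remains when the pair is completed on the side of the arm (\<open>empty_val (b - 2)\<close> for \<open>b \<ge> 1\<close>), and the
  negation of the value that remains when it is completed on the other side (\<open>empty_val (a - 1)\<close>);
  see \<open>arm_empty_val\<close> below.\<close>

definition arm_val :: "nat \<Rightarrow> bool" where
  "arm_val a \<longleftrightarrow> a mod 10 \<in> {0, 3, 7}"

text \<open>The premise of \<open>sum\<close> says that the cell between \<open>u\<close> and \<open>v\<close> is dead.  Truth values play the role of
  the values 0 and 1, so \<open>x \<noteq> y\<close> is their nim sum.\<close>

inductive valued :: "board \<Rightarrow> bool \<Rightarrow> bool" where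
  empty: "valued (replicate n False) (empty_val n)"
| single: "arm a \<Longrightarrow> arm b \<Longrightarrow>
    valued (replicate a False @ True # replicate b False) (arm_val a \<noteq> arm_val b)"
| enclosed: "m mod 5 = 4 \<Longrightarrow> valued (True # replicate m False @ [True]) (m mod 10 = 9)"
| pair: "valued [True, True] False"
| sum: "valued u x \<Longrightarrow> valued v y \<Longrightarrow> \<not> no_three (u @ True # v) \<Longrightarrow>
    valued (u @ False # v) (x \<noteq> y)"

lemma valued_no_three: "valued b x \<Longrightarrow> no_three b"
proof (induction rule: valued.induct)
  case (enclosed m)
  then have "m \<noteq> 0" by auto
  then show ?case by (cases m) auto
qed (auto simp: no_three_split)

lemma valued_rev: "valued b x \<Longrightarrow> valued (rev b) x"
proof (induction rule: valued.induct)
  case (single a b)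
  then show ?case using valued.single[of b a] by (simp add: eq_commute)
next
  case (enclosed m)
  then show ?case using valued.enclosed[of m] by simp
next
  case (sum u x v y)
  then show ?case
    using valued.sum[of "rev v" y "rev u" x] no_three_rev[of "u @ True # v"]
    by (simp add: eq_commute)
qed (use valued.empty valued.pair in auto)

lemma three_after [simp]: "\<not> no_three (u @ True # True # True # v)"
  using not_no_three_iff by blast

text \<open>The cell in front of an adjacent pair is dead whatever stands to its left; the mirror image follows.\<close>

lemma valued_before_pair:
  assumes "valued u x" and "valued (True # True # w) y"
  shows "valued (u @ False # True # True # w) (x \<noteq> y)"
  using assms by (intro valued.sum) auto

lemma valued_after_pair:
  assumes "valued (w @ [True, True]) x" and "valued v y"
  shows "valued (w @ True # True # False # v) (x \<noteq> y)"
  using valued.sum[OF assms] by simp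

text \<open>Truncated subtraction is right here: without an empty cell before the pair there is no dead cell
  either, and the empty board of length 0 has value 0.\<close>

lemma valued_empty_before_pair:
  assumes "valued (True # True # w) y"
  shows "valued (replicate a False @ True # True # w) (empty_val (a - 1) \<noteq> y)"
proof (cases a)
  case 0
  then show ?thesis using assms by (simp add: empty_val_def)
next
  case (Suc n)
  then show ?thesis
    using valued_before_pair[OF valued.empty[of n] assms]
    by (simp flip: replicate_append_same)
qed

lemma valued_pair_then_empty: "valued (True # True # replicate b False) (empty_val (b - 1))"
proof (cases b)
  case 0
  then show ?thesis using valued.pair by (simp add: empty_val_def)
next
  case (Suc n)
  then show ?thesis
    using valued_after_pair[of "[]" False, OF _ valued.empty[of n]] valued.pair by simp
qed

lemma valued_pair_among_empty:
  "valued (replicate a False @ True # True # replicate b False)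
    (empty_val (a - 1) \<noteq> empty_val (b - 1))"
  by (intro valued_empty_before_pair valued_pair_then_empty)

section \<open>Arithmetic of the values modulo ten\<close>

lemma mod10_cases:
  fixes n :: nat
  obtains "n mod 10 = 0" | "n mod 10 = 1" | "n mod 10 = 2" | "n mod 10 = 3" | "n mod 10 = 4"
    | "n mod 10 = 5" | "n mod 10 = 6" | "n mod 10 = 7" | "n mod 10 = 8" | "n mod 10 = 9"
proof -
  have "m = 0 \<or> m = 1 \<or> m = 2 \<or> m = 3 \<or> m = 4 \<or> m = 5 \<or> m = 6 \<or> m = 7 \<or> m = 8 \<or> m = 9"
    if "m < 10" for m :: nat
    using that by arith
  from this[of "n mod 10"] show thesis using that by auto
qed

lemma mod5_of_mod10: "(n::nat) mod 5 = n mod 10 mod 5"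
  by (simp add: mod_mod_cancel)

lemma arm_iff: "arm n \<longleftrightarrow> n mod 10 \<in> {0, 2, 3, 5, 7, 8}"
  unfolding arm_def mod5_of_mod10[of n] by (cases n rule: mod10_cases) simp_all

text \<open>Lengths shrink by one or two cells when a pair is made.  These lemmas express the resulting
  values by residues of the original length.  Because of truncated subtraction, residue 0 has a
  special case \<open>n = 0\<close>: there \<open>empty_val (n - 1)\<close> still follows the pattern, but \<open>empty_val (n - 2)\<close>
  does not.\<close>

lemma shift_one:
  "empty_val (n - 1) \<longleftrightarrow> n mod 10 \<in> {2, 5, 6, 8, 9}"
  "n \<ge> 1 \<Longrightarrow> arm (n - 1) \<longleftrightarrow> n mod 10 \<in> {1, 3, 4, 6, 8, 9}"
  "n \<ge> 1 \<Longrightarrow> arm_val (n - 1) \<longleftrightarrow> n mod 10 \<in> {1, 4, 8}"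
proof -
  have "(empty_val (n - 1) \<longleftrightarrow> n mod 10 \<in> {2, 5, 6, 8, 9})
    \<and> (n \<ge> 1 \<longrightarrow> (arm (n - 1) \<longleftrightarrow> n mod 10 \<in> {1, 3, 4, 6, 8, 9})
      \<and> (arm_val (n - 1) \<longleftrightarrow> n mod 10 \<in> {1, 4, 8}))"
  proof (cases n)
    case (Suc k)
    then show ?thesis
      by (cases k rule: mod10_cases; simp add: arm_iff empty_val_def arm_val_def mod_Suc)
  qed (simp add: empty_val_def)
  then show "empty_val (n - 1) \<longleftrightarrow> n mod 10 \<in> {2, 5, 6, 8, 9}"
    "n \<ge> 1 \<Longrightarrow> arm (n - 1) \<longleftrightarrow> n mod 10 \<in> {1, 3, 4, 6, 8, 9}"
    "n \<ge> 1 \<Longrightarrow> arm_val (n - 1) \<longleftrightarrow> n mod 10 \<in> {1, 4, 8}"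
    by blast+
qed

lemma shift_two:
  "n \<ge> 1 \<Longrightarrow> empty_val (n - 2) \<longleftrightarrow> n mod 10 \<in> {0, 3, 6, 7, 9}"
  "n \<ge> 2 \<Longrightarrow> arm (n - 2) \<longleftrightarrow> n mod 10 \<in> {0, 2, 4, 5, 7, 9}"
  "n \<ge> 2 \<Longrightarrow> arm_val (n - 2) \<longleftrightarrow> n mod 10 \<in> {2, 5, 9}"
proof -
  have "n \<ge> 1 \<longrightarrow> (empty_val (n - 2) \<longleftrightarrow> n mod 10 \<in> {0, 3, 6, 7, 9})
    \<and> (n \<ge> 2 \<longrightarrow> (arm (n - 2) \<longleftrightarrow> n mod 10 \<in> {0, 2, 4, 5, 7, 9})
      \<and> (arm_val (n - 2) \<longleftrightarrow> n mod 10 \<in> {2, 5, 9}))"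
  proof (cases "n \<ge> 2")
    case True
    define k where "k = n - 2"
    have "n = Suc (Suc k)" using True by (simp add: k_def)
    then show ?thesis
      by (cases k rule: mod10_cases; simp add: arm_iff empty_val_def arm_val_def mod_Suc)
  next
    case False
    then have "n = 0 \<or> n = 1" by auto
    then show ?thesis by (auto simp: empty_val_def)
  qed
  then show "n \<ge> 1 \<Longrightarrow> empty_val (n - 2) \<longleftrightarrow> n mod 10 \<in> {0, 3, 6, 7, 9}"
    "n \<ge> 2 \<Longrightarrow> arm (n - 2) \<longleftrightarrow> n mod 10 \<in> {0, 2, 4, 5, 7, 9}"
    "n \<ge> 2 \<Longrightarrow> arm_val (n - 2) \<longleftrightarrow> n mod 10 \<in> {2, 5, 9}"
    by auto
qed

lemma mod10_sum:
  fixes l r :: nat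
  shows "(l + r + 1) mod 10 = (l mod 10 + r mod 10 + 1) mod 10"
  by (metis mod_add_eq mod_add_left_eq)

lemma mod10_bounds:
  "n mod 10 \<noteq> 0 \<Longrightarrow> (n::nat) \<ge> 1"
  "n mod 10 \<noteq> 0 \<Longrightarrow> n mod 10 \<noteq> 1 \<Longrightarrow> (n::nat) \<ge> 2"
  "n mod 10 = 1 \<Longrightarrow> (n::nat) \<noteq> 1 \<Longrightarrow> n \<ge> 2"
  by (cases n; force)+

text \<open>Against a piece with \<open>l\<close> cells to its left and \<open>r\<close> to its right on an empty board, completing a
  pair to the left or to the right restores the value, except against a piece at an end of a board
  whose length is 1 or divisible by 5.\<close>

lemma empty_reply_arith:
  assumes n: "n = l + r + 1"
  shows "(l \<ge> 1 \<and> (empty_val (l - 2) \<noteq> empty_val (r - 1)) = empty_val n)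
    \<or> (r \<ge> 1 \<and> (empty_val (l - 1) \<noteq> empty_val (r - 2)) = empty_val n)
    \<or> (l = 0 \<or> r = 0) \<and> (n mod 5 = 0 \<or> n = 1)"
proof -
  have nm: "n mod 10 = (l mod 10 + r mod 10 + 1) mod 10"
    unfolding n by (rule mod10_sum)
  have n5: "n mod 5 = 0 \<longleftrightarrow> n mod 10 \<in> {0, 5}"
    unfolding mod5_of_mod10[of n] by (cases n rule: mod10_cases) simp_all
  have n1: "n = 1 \<longleftrightarrow> l = 0 \<and> r = 0" using n by auto
  show ?thesis
    unfolding n5 n1
    by (cases "l = 0"; cases "r = 0"; cases l rule: mod10_cases; cases r rule: mod10_cases;
        simp add: shift_one shift_two empty_val_def[of n] empty_val_def[of 0] nm del: One_nat_def)
qed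

text \<open>A single piece has a right arm of length \<open>l + r + 1\<close> in which the opponent leaves \<open>l\<close> cells before
  and \<open>r\<close> cells after the new piece.  Completing a pair at the left of the new piece leaves \<open>l - 2\<close>
  cells for the old arm, completing it at the right leaves \<open>l - 1\<close>.  The left arm contributes
  the same to both sides and drops out, so the condition concerns the right arm alone.  The
  exception is a new piece on the last cell, with \<open>l\<close> congruent to 1 modulo 5.\<close>

lemma arm_reply_arith:
  assumes "arm (l + r + 1)" and "l \<ge> 1"
  shows "(l \<ge> 2 \<and> arm (l - 2) \<and> (arm_val (l - 2) \<noteq> empty_val (r - 1)) = arm_val (l + r + 1))
    \<or> (r \<ge> 1 \<and> arm (l - 1) \<and> (arm_val (l - 1) \<noteq> empty_val (r - 2)) = arm_val (l + r + 1))
    \<or> (r = 0 \<and> l mod 5 = 1)"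
proof -
  have l5: "l mod 5 = 1 \<longleftrightarrow> l mod 10 \<in> {1, 6}"
    unfolding mod5_of_mod10[of l] by (cases l rule: mod10_cases) simp_all
  show ?thesis
    using assms unfolding l5 arm_iff[of "l + r + 1"] arm_val_def[of "l + r + 1"] mod10_sum[of l r]
    by (cases "l = 1"; cases "r = 0"; cases l rule: mod10_cases; cases r rule: mod10_cases;
        simp add: shift_one shift_two mod10_bounds empty_val_def[of 0] arm_def[of 0] arm_val_def[of 0]
        del: One_nat_def)
qed

text \<open>The opponent plays inside a gap between two pieces, leaving \<open>p\<close> and \<open>q\<close> cells.  A pair at the left or
  the right of the new piece leaves a single arm for each of the two enclosing pieces.\<close>

lemma enclosed_reply_arith:
  assumes "(p + q + 1) mod 5 = 4" and "p \<ge> 1" "q \<ge> 1"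
  shows "(p \<ge> 2 \<and> arm (p - 2) \<and> arm (q - 1)
        \<and> (arm_val (p - 2) \<noteq> arm_val (q - 1)) = ((p + q + 1) mod 10 = 9))
    \<or> (q \<ge> 2 \<and> arm (p - 1) \<and> arm (q - 2)
        \<and> (arm_val (p - 1) \<noteq> arm_val (q - 2)) = ((p + q + 1) mod 10 = 9))"
proof -
  have n5: "(p + q + 1) mod 5 = 4 \<longleftrightarrow> (p + q + 1) mod 10 \<in> {4, 9}"
    unfolding mod5_of_mod10[of "p + q + 1"] by (cases "p + q + 1" rule: mod10_cases) simp_all
  show ?thesis
    using assms unfolding n5 mod10_sum[of p q]
    by (cases "p = 1"; cases "q = 1"; cases p rule: mod10_cases; cases q rule: mod10_cases;
        simp add: shift_one shift_two mod10_bounds empty_val_def[of 0] arm_def[of 0] arm_val_def[of 0]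
        del: One_nat_def)
qed

text \<open>The identities that link single pieces to empty boards: completing a pair always flips the value
  of a single piece.\<close>

lemma arm_empty_val:
  "arm a \<Longrightarrow> empty_val (a - 1) \<longleftrightarrow> \<not> arm_val a"
  "arm b \<Longrightarrow> b \<ge> 1 \<Longrightarrow> empty_val (b - 2) \<longleftrightarrow> arm_val b"
  unfolding shift_one shift_two arm_iff arm_val_def by auto

section \<open>Replies to every move\<close>

text \<open>What it means that the move to \<open>c\<close> does not spoil the value \<open>x\<close>.\<close>

definition answered :: "board \<Rightarrow> bool \<Rightarrow> bool" where
  "answered c x \<longleftrightarrow> valued c (\<not> x) \<or> (\<exists>d. move c d \<and> valued d x)"

lemma answered_rev:
  assumes "answered (rev c) x"
  shows "answered c x"
  using assms valued_rev move_rev unfolding answered_def by (metis rev_rev_ident)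

lemma valued_move:
  "valued (u @ True # v) x \<Longrightarrow> move (u @ False # v) (u @ True # v)"
  using valued_no_three by (auto simp: move_iff)

lemma answeredI:
  assumes "valued d y" and "d = u @ True # v" and "c = u @ False # v" and "y = x"
  shows "answered c x"
  using assms valued_move unfolding answered_def by blast

lemma valued_left_end: "arm b \<Longrightarrow> valued (True # replicate b False) (\<not> arm_val b)"
  using valued.single[of 0 b] by (simp add: arm_def arm_val_def[of 0])

lemma valued_right_end: "arm a \<Longrightarrow> valued (replicate a False @ [True]) (\<not> arm_val a)"
  using valued.single[of a 0] by (simp add: arm_def arm_val_def[of 0])

lemma valued_lone_piece: "valued [True] False"
  using valued_left_end[of 0] by (simp add: arm_def arm_val_def)

declare replicate_app_Cons_same [simp]

text \<open>For \<open>n > 1\<close> the reply leaves exactly one cell between the two pieces.  That cell is dead, no move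
  remains next to the first piece, and the second one keeps an arm of length \<open>n - 3\<close>, which is
  congruent to 2 modulo 5.\<close>

lemma answered_in_empty_end:
  assumes "n = r + 1" and "n mod 5 = 0 \<or> n = 1"
  shows "answered (True # replicate r False) (empty_val n)"
proof (cases "n = 1")
  case True
  then show ?thesis
    using valued_lone_piece assms(1) by (simp add: answered_def empty_val_def)
next
  case False
  then have n5: "n mod 5 = 0" using assms(2) by simp
  then have "r \<ge> 2" using assms(1) False by (cases "r = 1") auto
  then obtain k where r: "r = Suc (Suc k)" by (metis Suc_le_D numeral_2_eq_2 Suc_le_mono)
  have n: "n = Suc (Suc (Suc k))" using assms(1) r by simp
  have "n mod 10 mod 5 = 0" using n5 mod5_of_mod10[of n] by simp
  then have k: "arm k" "(\<not> arm_val k) = empty_val n"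
    unfolding n by (cases k rule: mod10_cases; simp add: arm_iff arm_val_def empty_val_def mod_Suc)+
  have "valued ([True] @ False # True # replicate k False) (False \<noteq> (\<not> arm_val k))"
    using valued_lone_piece valued_left_end[OF k(1)] three_after[of "[]"]
    by (intro valued.sum) auto
  then show ?thesis
    by (rule answeredI[where u = "[True, False]" and v = "replicate k False"])
      (use k r in auto)
qed

lemma answered_in_empty:
  assumes "move (replicate n False) c"
  shows "answered c (empty_val n)"
proof -
  obtain l r where n: "n = l + r + 1" and c: "c = replicate l False @ True # replicate r False"
    using move_replicate[OF assms] by blast
  consider "l \<ge> 1" "(empty_val (l - 2) \<noteq> empty_val (r - 1)) = empty_val n"
    | "r \<ge> 1" "(empty_val (l - 1) \<noteq> empty_val (r - 2)) = empty_val n"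
    | "l = 0" "n mod 5 = 0 \<or> n = 1" | "r = 0" "n mod 5 = 0 \<or> n = 1"
    using empty_reply_arith[OF n] by blast
  then show ?thesis
  proof cases
    case 1
    then obtain k where l: "l = Suc k" by (cases l) auto
    show ?thesis
      by (rule answeredI[OF valued_pair_among_empty[of k r],
            where u = "replicate k False" and v = "True # replicate r False"])
        (use 1 c l in auto)
  next
    case 2
    then obtain k where r: "r = Suc k" by (cases r) auto
    show ?thesis
      by (rule answeredI[OF valued_pair_among_empty[of l k],
            where u = "replicate l False @ [True]" and v = "replicate k False"])
        (use 2 c r in auto)
  next
    case 3
    then show ?thesis using answered_in_empty_end[of n r] n c by simp
  next
    case 4
    then show ?thesis
      using answered_in_empty_end[of n l] n c by - (rule answered_rev, simp)
  qed
qed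

text \<open>For \<open>l > 1\<close> the reply is again next but one to the first piece and encloses a gap of length \<open>l - 2\<close>
  between two pieces; for \<open>l = 1\<close> the gap is a dead cell and the value has already changed.  The
  original position is a single piece at the left end with an arm of length \<open>l + 1\<close>.\<close>

lemma answered_two_pieces_at_ends:
  assumes "l mod 5 = 1"
  shows "answered (True # replicate l False @ [True]) (\<not> arm_val (l + 1))"
proof (cases "l = 1")
  case True
  have "valued ([True] @ False # [True]) (False \<noteq> False)"
    using valued_lone_piece three_after[of "[]" "[]"] by (intro valued.sum) auto
  then show ?thesis
    using True by (simp add: answered_def arm_val_def)
next
  case False
  then have "l \<ge> 2" using assms by (cases l) auto
  then obtain m where l: "l = Suc (Suc m)" by (metis Suc_le_D numeral_2_eq_2 Suc_le_mono)
  have "l mod 10 mod 5 = 1" using assms mod5_of_mod10[of l] by simp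
  then have m: "m mod 5 = 4" "(m mod 10 = 9) = (\<not> arm_val (l + 1))"
    unfolding l mod5_of_mod10[of m] by (cases m rule: mod10_cases; simp add: arm_val_def mod_Suc)+
  have "valued ([True] @ False # True # replicate m False @ [True]) (False \<noteq> (m mod 10 = 9))"
    using valued_lone_piece valued.enclosed[OF m(1)] three_after[of "[]"]
    by (intro valued.sum) auto
  then show ?thesis
    by (rule answeredI[where u = "[True, False]" and v = "replicate m False @ [True]"])
      (use m l in auto)
qed

text \<open>The three gaps \<open>a\<close>, \<open>l\<close>, \<open>r\<close> around the old and the new piece decide the reply: a pair with the
  new piece where the arithmetic allows it.  Otherwise the new piece is on the last cell, and
  the left arm provides room for a pair with the old piece, unless that arm is empty.\<close>

lemma answered_in_right_arm:
  assumes "arm a" and b: "arm (l + r + 1)"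
    and c: "c = replicate a False @ True # replicate l False @ True # replicate r False"
  shows "answered c (arm_val a \<noteq> arm_val (l + r + 1))"
proof -
  consider "l = 0"
    | "l \<ge> 2" "arm (l - 2)" "(arm_val (l - 2) \<noteq> empty_val (r - 1)) = arm_val (l + r + 1)"
    | "l \<ge> 1" "r \<ge> 1" "arm (l - 1)"
      "(arm_val (l - 1) \<noteq> empty_val (r - 2)) = arm_val (l + r + 1)"
    | "a = 0" "r = 0" "l mod 5 = 1" | "a \<ge> 1" "r = 0" "l mod 5 = 1"
    using arm_reply_arith[OF b] by (cases "l = 0"; cases "a = 0") auto
  then show ?thesis
  proof cases
    case 1
    \<comment> \<open>the opponent has completed a pair, which already changes the value\<close>
    have "empty_val (r - 1) = arm_val (r + 1)"
      using arm_empty_val(2)[OF b] 1 by simp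
    then have "valued c (\<not> (arm_val a \<noteq> arm_val (l + r + 1)))"
      using valued_pair_among_empty[of a r] arm_empty_val(1)[OF assms(1)] 1 c by simp
    then show ?thesis by (simp add: answered_def)
  next
    case 2
    then obtain k where l: "l = Suc (Suc k)" by (metis Suc_le_D numeral_2_eq_2 Suc_le_mono)
    have "valued ((replicate a False @ True # replicate k False) @ False # True # True # replicate r False)
      ((arm_val a \<noteq> arm_val k) \<noteq> empty_val (r - 1))"
      by (rule valued_before_pair[OF valued.single valued_pair_then_empty])
        (use assms(1) 2 l in auto)
    then show ?thesis
      by (rule answeredI[where u = "replicate a False @ True # replicate k False @ [False]"
            and v = "True # replicate r False"])
        (use 2 c l in auto)
  next
    case 3
    then obtain k j where l: "l = Suc k" and r: "r = Suc j" by (cases l; cases r) auto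
    have "valued ((replicate a False @ True # replicate k False) @ False # True # True # replicate j False)
      ((arm_val a \<noteq> arm_val k) \<noteq> empty_val (j - 1))"
      by (rule valued_before_pair[OF valued.single valued_pair_then_empty])
        (use assms(1) 3 l in auto)
    then show ?thesis
      by (rule answeredI[where u = "replicate a False @ True # replicate k False @ [False, True]"
            and v = "replicate j False"])
        (use 3 c l r in auto)
  next
    case 4
    then show ?thesis
      using answered_two_pieces_at_ends[of l] c by (simp add: arm_val_def[of 0])
  next
    case 5
    then obtain i where a: "a = Suc i" by (cases a) auto
    obtain k where l: "l = Suc k" using 5 by (cases l) auto
    have "l mod 10 mod 5 = 1" using 5 mod5_of_mod10[of l] by simp
    then have k: "arm k" "(\<not> arm_val k) = arm_val (l + 1)"
      unfolding l by (cases k rule: mod10_cases; simp add: arm_iff arm_val_def mod_Suc)+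
    have "valued (True # True # False # replicate k False @ [True]) (\<not> arm_val k)"
      using valued_after_pair[of "[]" False, OF _ valued_right_end[OF k(1)]] valued.pair by simp
    then have "valued (replicate i False @ True # True # False # replicate k False @ [True])
      (empty_val (i - 1) \<noteq> (\<not> arm_val k))"
      by (rule valued_empty_before_pair)
    moreover have "empty_val (i - 1) = arm_val a"
      using arm_empty_val(2)[OF assms(1)] a by simp
    ultimately show ?thesis
      by (intro answeredI[where u = "replicate i False"
            and v = "True # False # replicate k False @ [True]"])
        (use 5 k c l a in auto)
  qed
qed

lemma answered_in_single:
  assumes "arm a" and "arm b"
    and "move (replicate a False @ True # replicate b False) c"
  shows "answered c (arm_val a \<noteq> arm_val b)"
  using assms(3)
proof (cases rule: move_around_piece)
  case (1 u)
  then obtain l r where "a = l + r + 1" "u = replicate l False @ True # replicate r False"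
    using move_replicate by blast
  then show ?thesis
    using answered_in_right_arm[of b r l "rev c"] assms 1(2)
    by - (rule answered_rev, simp add: add.commute eq_commute)
next
  case (2 v)
  then obtain l r where "b = l + r + 1" "v = replicate l False @ True # replicate r False"
    using move_replicate by blast
  then show ?thesis
    using answered_in_right_arm[of a l r c] assms 2(2) by simp
qed

text \<open>A move next to one of the enclosing pieces already completes a pair; it leaves a single piece of the
  opposite value.\<close>

lemma answered_next_to_end:
  assumes "(q + 1) mod 5 = 4"
  shows "answered (True # True # replicate q False @ [True]) ((q + 1) mod 10 = 9)"
proof -
  obtain k where q: "q = Suc k" using assms by (cases q) auto
  have "(q + 1) mod 10 mod 5 = 4" using assms mod5_of_mod10[of "q + 1"] by simp
  then have k: "arm k" "arm_val k = ((q + 1) mod 10 = 9)"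
    unfolding q by (cases k rule: mod10_cases; simp add: arm_iff arm_val_def mod_Suc)+
  have "valued (True # True # False # replicate k False @ [True]) (\<not> arm_val k)"
    using valued_after_pair[of "[]" False, OF _ valued_right_end[OF k(1)]] valued.pair by simp
  then show ?thesis using k q by (simp add: answered_def)
qed

text \<open>Away from the two enclosing pieces, a pair with the new piece separates them into two single
  pieces with one arm each.\<close>

lemma answered_in_enclosed:
  assumes m: "m mod 5 = 4" and "move (True # replicate m False @ [True]) c"
  shows "answered c (m mod 10 = 9)"
proof -
  have pair: "valued (True # replicate k False @ False # True # True # False # replicate j False @ [True])
      (m mod 10 = 9)"
    if kj: "arm k" "arm j" "(arm_val k \<noteq> arm_val j) = (m mod 10 = 9)" for k j
  proof -
    have "valued (True # True # False # replicate j False @ [True]) (\<not> arm_val j)"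
      using valued_after_pair[of "[]" False, OF _ valued_right_end[OF kj(2)]] valued.pair by simp
    from valued_before_pair[OF valued_left_end[OF kj(1)] this] kj(3) show ?thesis
      by (auto split: if_splits)
  qed
  have no_move_Nil: "\<not> move [] w" for w
    by (simp add: move_def)
  obtain w where w: "move (replicate m False @ True # []) w" "c = True # w"
    using move_around_piece[of "[]" "replicate m False @ [True]" c] assms(2) no_move_Nil by auto
  obtain u where u: "move (replicate m False) u" "w = u @ [True]"
    using w(1) no_move_Nil by (auto elim: move_around_piece)
  obtain p q where pq: "m = p + q + 1" "u = replicate p False @ True # replicate q False"
    using move_replicate[OF u(1)] by blast
  have c: "c = True # replicate p False @ True # replicate q False @ [True]"
    using w(2) u(2) pq(2) by simp
  consider "p = 0" | "q = 0"
    | "p \<ge> 2" "q \<ge> 1" "arm (p - 2)" "arm (q - 1)" "(arm_val (p - 2) \<noteq> arm_val (q - 1)) = (m mod 10 = 9)"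
    | "p \<ge> 1" "q \<ge> 2" "arm (p - 1)" "arm (q - 2)" "(arm_val (p - 1) \<noteq> arm_val (q - 2)) = (m mod 10 = 9)"
    using enclosed_reply_arith[of p q] m unfolding pq(1)
    by (metis One_nat_def Suc_leI neq0_conv)
  then show ?thesis
  proof cases
    case 1
    then show ?thesis using answered_next_to_end[of q] m pq c by simp
  next
    case 2
    then show ?thesis
      using answered_next_to_end[of p] m pq c by - (rule answered_rev, simp)
  next
    case 3
    define k j where "k = p - 2" and "j = q - 1"
    with 3 have "p = Suc (Suc k)" "q = Suc j" by auto
    then show ?thesis
      using pair[of k j] 3 c
      by (intro answeredI[where u = "True # replicate k False @ [False]"
            and v = "True # False # replicate j False @ [True]"]) auto
  next
    case 4
    define k j where "k = p - 1" and "j = q - 2"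
    with 4 have "p = Suc k" "q = Suc (Suc j)" by auto
    then show ?thesis
      using pair[of k j] 4 c
      by (intro answeredI[where u = "True # replicate k False @ [False, True]"
            and v = "False # replicate j False @ [True]"]) auto
  qed
qed

lemma no_move_pair: "\<not> move [True, True] c"
  by (auto simp: move_iff Cons_eq_append_conv)

text \<open>In a sum the reply is made on the side of the dead cell on which the opponent moved.\<close>

lemma valued_answered: "valued b x \<Longrightarrow> move b c \<Longrightarrow> answered c x"
proof (induction arbitrary: c rule: valued.induct)
  case (sum u x v y)
  have nt: "no_three u" "no_three v" using sum.hyps valued_no_three by auto
  from sum.prems sum.hyps(3) show ?case
  proof (cases rule: move_in_sum)
    case (1 u')
    note dead = still_dead[OF sum.hyps(3) 1(1)]
    from sum.IH(1)[OF 1(1)] consider "valued u' (\<not> x)"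
      | u'' where "move u' u''" "valued u'' x" unfolding answered_def by blast
    then show ?thesis
    proof cases
      case A: 1
      then show ?thesis
        using valued.sum[OF A sum.hyps(2) dead] 1(2) by (simp add: answered_def)
    next
      case (2 u'')
      then show ?thesis
        using valued.sum[OF 2(2) sum.hyps(2) still_dead[OF dead 2(1)]]
          move_sum_left[OF 2(1) nt(2)] 1(2) unfolding answered_def by blast
    qed
  next
    case (2 v')
    note dead = still_dead_right[OF sum.hyps(3) 2(1)]
    from sum.IH(2)[OF 2(1)] consider "valued v' (\<not> y)"
      | v'' where "move v' v''" "valued v'' y" unfolding answered_def by blast
    then show ?thesis
    proof cases
      case A: 1
      then show ?thesis
        using valued.sum[OF sum.hyps(1) A dead] 2(2) by (simp add: answered_def)
    next
      case B: (2 v'')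
      then show ?thesis
        using valued.sum[OF sum.hyps(1) B(2) still_dead_right[OF dead B(1)]]
          move_sum_right[OF B(1) nt(1)] 2(2) unfolding answered_def by blast
    qed
  qed
qed (use answered_in_empty answered_in_single answered_in_enclosed no_move_pair in auto)

lemma move_to_pair_beside:
  assumes "arm a" "arm b" "b \<ge> 1" "arm_val a \<noteq> arm_val b"
  shows "\<exists>d. move (replicate a False @ True # replicate b False) d \<and> valued d False"
proof -
  obtain k where b: "b = Suc k" using assms(3) by (cases b) auto
  have "valued (replicate a False @ True # True # replicate k False) False"
    using valued_pair_among_empty[of a k] arm_empty_val[of a] arm_empty_val[of b] assms b by simp
  then show ?thesis
    using valued_move[of "replicate a False @ [True]" "replicate k False" False] b by auto
qed

text \<open>From an empty board of value 1 there is an opening move to a single piece of value 0; from the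
  other components of value 1, a piece next to an existing one does it.\<close>

lemma valued_True_move:
  "valued b x \<Longrightarrow> x \<Longrightarrow> \<exists>d. move b d \<and> valued d False"
proof (induction rule: valued.induct)
  case (empty n)
  \<comment> \<open>the opening move leaves 0, 2 or 3 cells at its left, according to the residue of the length\<close>
  have "\<exists>l r. n = l + r + 1 \<and> arm l \<and> arm r \<and> arm_val l = arm_val r"
  proof -
    consider "n mod 10 \<in> {1, 4, 8}" | "n mod 10 = 5" | "n mod 10 = 7"
      using empty by (auto simp: empty_val_def)
    then show ?thesis
    proof cases
      case 1
      then have "n = 0 + (n - 1) + 1" by (cases n) auto
      moreover have "arm (n - 1)" "arm_val (n - 1)"
        using 1 shift_one(2,3)[of n] by (auto simp: mod10_bounds)
      ultimately show ?thesis by (intro exI[of _ 0] exI[of _ "n - 1"]) (auto simp: arm_def arm_val_def)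
    next
      case 2
      then have "n \<ge> 3" by (cases "n = 0"; cases "n = 1"; cases "n = 2"; simp)
      define k where "k = n - 3"
      then have n: "n = Suc (Suc (Suc k))" using \<open>n \<ge> 3\<close> by simp
      have "k mod 10 = 2"
        using 2 unfolding n by (cases k rule: mod10_cases; simp add: mod_Suc)
      then show ?thesis using n
        by (intro exI[of _ 2] exI[of _ k]) (auto simp: arm_iff arm_val_def)
    next
      case 3
      then have "n \<ge> 4" by (cases "n = 0"; cases "n = 1"; cases "n = 2"; cases "n = 3"; simp)
      define k where "k = n - 4"
      then have n: "n = Suc (Suc (Suc (Suc k)))" using \<open>n \<ge> 4\<close> by simp
      have "k mod 10 = 3"
        using 3 unfolding n by (cases k rule: mod10_cases; simp add: mod_Suc)
      then show ?thesis using n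
        by (intro exI[of _ 3] exI[of _ k]) (auto simp: arm_iff arm_val_def)
    qed
  qed
  then obtain l r where lr: "n = l + r + 1" "arm l" "arm r" "arm_val l = arm_val r" by blast
  have "valued (replicate l False @ True # replicate r False) False"
    using valued.single[OF lr(2,3)] lr(4) by simp
  then show ?case
    using valued_move[of "replicate l False" "replicate r False" False] lr(1)
    by (intro exI[of _ "replicate l False @ True # replicate r False"]) (simp add: replicate_add)
next
  case (single a b)
  show ?case
  proof (cases "b = 0")
    case False
    then show ?thesis using move_to_pair_beside single by auto
  next
    case True
    then have "a \<noteq> 0" using single by (intro notI) simp
    then obtain d where "move (replicate b False @ True # replicate a False) d" "valued d False"
      using move_to_pair_beside[of b a] single by auto
    then show ?thesis
      using move_rev[of "replicate b False @ True # replicate a False" d] valued_rev by auto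
  qed
next
  case (enclosed m)
  then obtain k where m: "m = Suc (Suc k)" by (cases m; cases "m - 1") auto
  then have k: "arm k" "arm_val k"
    using enclosed.prems unfolding m
    by (cases k rule: mod10_cases; simp add: arm_iff arm_val_def mod_Suc)+
  have "valued (True # True # False # replicate k False @ [True]) False"
    using valued_after_pair[of "[]" False, OF _ valued_right_end[OF k(1)]] valued.pair k(2) by simp
  then show ?case
    using valued_move[of "[True]" "False # replicate k False @ [True]" False] m by auto
next
  case (sum u x v y)
  have nt: "no_three u" "no_three v" using sum.hyps valued_no_three by auto
  show ?case
  proof (cases x)
    case True
    then obtain u' where u': "move u u'" "valued u' False" using sum.IH(1) by blast
    then have "valued (u' @ False # v) False"
      using valued.sum[OF u'(2) sum.hyps(2) still_dead[OF sum.hyps(3) u'(1)]] True sum.prems by simp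
    then show ?thesis using move_sum_left[OF u'(1) nt(2)] by blast
  next
    case False
    then obtain v' where v': "move v v'" "valued v' False" using sum.IH(2) sum.prems by blast
    then have "valued (u @ False # v') False"
      using valued.sum[OF sum.hyps(1) v'(2) still_dead_right[OF sum.hyps(3) v'(1)]] False by simp
    then show ?thesis using move_sum_right[OF v'(1) nt(1)] by blast
  qed
qed simp

section \<open>Sprague-Grundy values and outcomes\<close>

lemma finite_moves: "finite {c. move b c}"
proof (rule finite_subset)
  show "{c. move b c} \<subseteq> (\<lambda>i. b[i := True]) ` {..<length b}"
    by (auto simp: move_def)
qed simp

lemma mex_notin: "finite A \<Longrightarrow> mex A \<notin> A"
  unfolding mex_def by (rule LeastI_ex) (use ex_new_if_finite infinite_UNIV_nat in blast)

text \<open>Only finitely many options exist, so the least excluded value really is excluded.\<close>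

lemma sg_option_ne: "move b c \<Longrightarrow> sg c \<noteq> sg b"
  using mex_notin[of "sg ` {c. move b c}"] finite_moves[of b] sg.simps[of b] by force

lemma sg_below_option: "k < sg b \<Longrightarrow> \<exists>c. move b c \<and> sg c = k"
  using not_less_Least[of k "\<lambda>k. k \<notin> sg ` {c. move b c}"] sg.simps[of b]
  by (auto simp: mex_def)

lemma sg_eqI:
  assumes "\<And>c. move b c \<Longrightarrow> sg c \<noteq> k" and "\<And>j. j < k \<Longrightarrow> \<exists>c. move b c \<and> sg c = j"
  shows "sg b = k"
  using assms sg_below_option[of k b] sg_option_ne by (metis linorder_neqE_nat)

lemma valued_sg: "valued b x \<Longrightarrow> sg b = of_bool x"
proof (induction "length (filter Not b)" arbitrary: b x rule: less_induct)
  case less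
  have IH: "sg c = of_bool y" if "move b c" "valued c y" for c y
    using less.hyps that move_fewer_empty_cells by blast
  show ?case
  proof (rule sg_eqI)
    fix c assume c: "move b c"
    from valued_answered[OF less.prems c] consider "valued c (\<not> x)"
      | d where "move c d" "valued d x" unfolding answered_def by blast
    then show "sg c \<noteq> of_bool x"
    proof cases
      case 1
      then show ?thesis using IH[OF c] by auto
    next
      case (2 d)
      \<comment> \<open>the reply gives \<open>c\<close> an option of value \<open>x\<close>\<close>
      have "length (filter Not d) < length (filter Not b)"
        using c 2(1) move_fewer_empty_cells less_trans by blast
      then show ?thesis using less.hyps 2 sg_option_ne by metis
    qed
  next
    fix j :: nat assume "j < of_bool x"
    then have "x \<and> j = 0" by (cases x) auto
    then show "\<exists>c. move b c \<and> sg c = j"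
      using valued_True_move[OF less.prems] IH by fastforce
  qed
qed

lemma loses_iff_sg: "loses b \<longleftrightarrow> sg b = 0"
proof (induction "length (filter Not b)" arbitrary: b rule: less_induct)
  case less
  have IH: "loses d \<longleftrightarrow> sg d = 0" if "move b c" "move c d" for c d
    using less that move_fewer_empty_cells less_trans by blast
  have "loses b \<longleftrightarrow> (\<forall>c. move b c \<longrightarrow> (\<exists>d. move c d \<and> loses d))"
    by (subst loses.simps) auto
  also have "\<dots> \<longleftrightarrow> (\<forall>c. move b c \<longrightarrow> sg c \<noteq> 0)"
    using IH sg_below_option sg_option_ne by (metis gr0I)
  also have "\<dots> \<longleftrightarrow> sg b = 0"
    using sg_below_option sg_option_ne by (metis gr0I)
  finally show ?case .
qed

theorem theorem1p1:
  fixes n :: nat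
  shows "(sg (empty_board n) = 0 \<longleftrightarrow> n mod 10 \<in> {0, 2, 3, 6, 9})
    \<and> (loses (empty_board n) \<longleftrightarrow> n mod 10 \<in> {0, 2, 3, 6, 9})
    \<and> (n mod 10 \<in> {1, 4, 5, 7, 8} \<longrightarrow> sg (empty_board n) = 1)"
proof -
  have "sg (empty_board n) = of_bool (empty_val n)"
    unfolding empty_board_def by (intro valued_sg valued.empty)
  then show ?thesis
    unfolding loses_iff_sg empty_val_def by (cases n rule: mod10_cases) simp_all
qed

end
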